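(* Let $R$ be a unital ring with involution $*$ and let $a\in R$ be both group invertible and Moore-Penrose invertible. Then (all the inverses and idempotents below exist and): (i) $p_{a^\#}=p_a$, $q_{a^\#}=q_a$, $r_{a^\#}=r_a$ and $$(a^\#)^\#=a,\quad (a^\#)^\dagger=r_aap_a,\quad (a^\#)^{\mathrm{core}}=ap_a,\quad (a^\#)_{\mathrm{core}}=r_aa.$$ (ii) $p_{a^\dagger}=r_a$, $q_{a^\dagger}=q_a^*$, $r_{a^\dagger}=p_a$ and $$(a^\dagger)^\#=q_a^*aq_a^*,\quad (a^\dagger)^\dagger=a,\quad (a^\dagger)^{\mathrm{core}}=q_a^*a,\quad (a^\dagger)_{\mathrm{core}}=aq_a^*.$$ (iii) With $b=a^{\mathrm{core}}$: $p_b=q_b=r_b=p_a$ and $$b^\#=b^\dagger=b^{\mathrm{core}}=b_{\mathrm{core}}=ap_a.$$ (iv) With $c=a_{\mathrm{core}}$: $p_c=q_c=r_c=r_a$ and $$c^\#=c^\dagger=c^{\mathrm{core}}=c_{\mathrm{core}}=r_aa.$$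
   Context: For $a\in R$: $aR=\{ax:x\in R\}$, $Ra=\{xa:x\in R\}$. Inverses (each unique when it exists): the group inverse $a^\#$ is the $x$ with $axa=a$, $xax=x$, $ax=xa$; the Moore-Penrose inverse $a^\dagger$ is the $x$ with $axa=a$, $xax=x$, $(ax)^*=ax$, $(xa)^*=xa$; the core inverse $a^{\mathrm{core}}$ is the $x$ with $axa=a$, $xR=aR$, $Rx=Ra^*$; the dual core inverse $a_{\mathrm{core}}$ is the $x$ with $axa=a$, $xR=a^*R$, $Rx=Ra$. Idempotents (each unique when it exists): $p_a$ is the self-adjoint idempotent with $p_aR=aR$; $r_a$ is the self-adjoint idempotent with $Rr_a=Ra$; $q_a$ is the idempotent with $q_aR=aR$ and $Rq_a=Ra$. If $a$ is both group and Moore-Penrose invertible, then $a$ is core and dual core invertible and $p_a,q_a,r_a$ all exist. *)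

theory Defs
  imports Main
begin

text \<open>
  The class extends \<open>{ring, monoid_mult}\<close> rather than \<open>ring_1\<close> because
  \<open>ring_1\<close> excludes the zero ring.
\<close>

class involution_ring = ring + monoid_mult +
  fixes star :: "'a \<Rightarrow> 'a"
  assumes star_star: "star (star x) = x"
    and star_add: "star (x + y) = star x + star y"
    and star_mult: "star (x * y) = star y * star x"

definition right_mults :: "'a::times \<Rightarrow> 'a set" where
  "right_mults a = {a * x | x. True}"

definition left_mults :: "'a::times \<Rightarrow> 'a set" where
  "left_mults a = {x * a | x. True}"

definition is_group_inv :: "'a::involution_ring \<Rightarrow> 'a \<Rightarrow> bool" where
  "is_group_inv a x \<longleftrightarrow> a * x * a = a \<and> x * a * x = x \<and> a * x = x * a"

definition is_mp_inv :: "'a::involution_ring \<Rightarrow> 'a \<Rightarrow> bool" where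
  "is_mp_inv a x \<longleftrightarrow>
     a * x * a = a \<and> x * a * x = x \<and> star (a * x) = a * x \<and> star (x * a) = x * a"

definition is_core_inv :: "'a::involution_ring \<Rightarrow> 'a \<Rightarrow> bool" where
  "is_core_inv a x \<longleftrightarrow>
     a * x * a = a \<and> right_mults x = right_mults a \<and> left_mults x = left_mults (star a)"

definition is_dual_core_inv :: "'a::involution_ring \<Rightarrow> 'a \<Rightarrow> bool" where
  "is_dual_core_inv a x \<longleftrightarrow>
     a * x * a = a \<and> right_mults x = right_mults (star a) \<and> left_mults x = left_mults a"

definition is_p_idem :: "'a::involution_ring \<Rightarrow> 'a \<Rightarrow> bool" where
  "is_p_idem a e \<longleftrightarrow> e * e = e \<and> star e = e \<and> right_mults e = right_mults a"

definition is_q_idem :: "'a::involution_ring \<Rightarrow> 'a \<Rightarrow> bool" where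
  "is_q_idem a e \<longleftrightarrow> e * e = e \<and> right_mults e = right_mults a \<and> left_mults e = left_mults a"

definition is_r_idem :: "'a::involution_ring \<Rightarrow> 'a \<Rightarrow> bool" where
  "is_r_idem a e \<longleftrightarrow> e * e = e \<and> star e = e \<and> left_mults e = left_mults a"

text \<open>
  Each of the following is a definite description; it is meaningful only where the element
  exists. Uniqueness is proved at the end of this theory.
\<close>

definition group_inv :: "'a::involution_ring \<Rightarrow> 'a" where
  "group_inv a = (THE x. is_group_inv a x)"

definition mp_inv :: "'a::involution_ring \<Rightarrow> 'a" where
  "mp_inv a = (THE x. is_mp_inv a x)"

definition core_inv :: "'a::involution_ring \<Rightarrow> 'a" where
  "core_inv a = (THE x. is_core_inv a x)"

definition dual_core_inv :: "'a::involution_ring \<Rightarrow> 'a" where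
  "dual_core_inv a = (THE x. is_dual_core_inv a x)"

definition p_idem :: "'a::involution_ring \<Rightarrow> 'a" where
  "p_idem a = (THE e. is_p_idem a e)"

definition q_idem :: "'a::involution_ring \<Rightarrow> 'a" where
  "q_idem a = (THE e. is_q_idem a e)"

definition r_idem :: "'a::involution_ring \<Rightarrow> 'a" where
  "r_idem a = (THE e. is_r_idem a e)"

definition group_invertible :: "'a::involution_ring \<Rightarrow> bool" where
  "group_invertible a \<longleftrightarrow> (\<exists>x. is_group_inv a x)"

definition mp_invertible :: "'a::involution_ring \<Rightarrow> bool" where
  "mp_invertible a \<longleftrightarrow> (\<exists>x. is_mp_inv a x)"

definition core_invertible :: "'a::involution_ring \<Rightarrow> bool" where
  "core_invertible a \<longleftrightarrow> (\<exists>x. is_core_inv a x)"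

definition dual_core_invertible :: "'a::involution_ring \<Rightarrow> bool" where
  "dual_core_invertible a \<longleftrightarrow> (\<exists>x. is_dual_core_inv a x)"

lemma is_group_inv_unique:
  assumes x: "is_group_inv a x" and y: "is_group_inv a y"
  shows "x = y"
proof -
  have 1: "a * x = a * y * (a * x)"
    using y unfolding is_group_inv_def by (metis mult.assoc)
  have 2: "a * y = a * y * (a * x)"
    using x y unfolding is_group_inv_def by (metis mult.assoc)
  have e: "a * x = a * y" using 1 2 by simp
  have "x = x * a * y" using x e unfolding is_group_inv_def by (metis mult.assoc)
  also have "\<dots> = a * y * y" using x e unfolding is_group_inv_def by metis
  also have "\<dots> = y" using y unfolding is_group_inv_def by (metis mult.assoc)
  finally show ?thesis .
qed

lemma is_mp_inv_unique:
  assumes x: "is_mp_inv a x" and y: "is_mp_inv a y"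
  shows "x = y"
proof -
  have 1: "a * x = a * y * (a * x)" and 2: "a * y = a * x * (a * y)"
    and 3: "x * a = x * a * (y * a)" and 4: "y * a = y * a * (x * a)"
    using x y unfolding is_mp_inv_def by (metis mult.assoc)+
  have e: "a * x = a * y" using 1 2 x y unfolding is_mp_inv_def by (metis star_mult)
  have f: "x * a = y * a" using 3 4 x y unfolding is_mp_inv_def by (metis star_mult)
  have "x = x * a * x" using x unfolding is_mp_inv_def by simp
  also have "\<dots> = y * a * y" using e f by (metis mult.assoc)
  also have "\<dots> = y" using y unfolding is_mp_inv_def by simp
  finally show ?thesis .
qed

lemma right_multsD:
  "right_mults (x::'a::monoid_mult) = right_mults a \<Longrightarrow> \<exists>s. x = a * s"
  unfolding right_mults_def by (smt (verit) mem_Collect_eq mult.right_neutral)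

lemma left_multsD:
  "left_mults (x::'a::monoid_mult) = left_mults a \<Longrightarrow> \<exists>s. x = s * a"
  unfolding left_mults_def by (smt (verit) mem_Collect_eq mult.left_neutral)

lemma is_core_invD:
  assumes "is_core_inv a x"
  shows "star (a * x) = a * x" "x * a * x = x"
proof -
  have axa: "a * x * a = a" using assms unfolding is_core_inv_def by simp
  obtain w where w: "x = w * star a"
    using assms left_multsD unfolding is_core_inv_def by blast
  have "star a = star a * star (a * x)" using axa by (metis star_mult)
  then have xx: "x = x * star (a * x)" using w by (metis mult.assoc)
  then have "a * x = a * x * star (a * x)" by (metis mult.assoc)
  then show "star (a * x) = a * x" by (metis star_mult star_star)
  then show "x * a * x = x" using xx by (metis mult.assoc)
qed

lemma is_core_inv_unique:
  assumes x: "is_core_inv a x" and y: "is_core_inv a y"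
  shows "x = y"
proof -
  have axa: "a * x * a = a" "a * y * a = a"
    using x y unfolding is_core_inv_def by auto
  have "a * x = a * y * (a * x)" "a * y = a * x * (a * y)"
    using axa by (metis mult.assoc)+
  then have e: "a * x = a * y"
    using is_core_invD(1)[OF x] is_core_invD(1)[OF y] by (metis star_mult)
  obtain s where s: "x = y * s"
    using x y right_multsD unfolding is_core_inv_def by metis
  have "x = y * a * x" using s is_core_invD(2)[OF y] by (metis mult.assoc)
  also have "\<dots> = y" using e is_core_invD(2)[OF y] by (metis mult.assoc)
  finally show ?thesis .
qed

lemma is_dual_core_invD:
  assumes "is_dual_core_inv a x"
  shows "star (x * a) = x * a" "x * a * x = x"
proof -
  have axa: "a * x * a = a" using assms unfolding is_dual_core_inv_def by simp
  obtain w where w: "x = star a * w"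
    using assms right_multsD unfolding is_dual_core_inv_def by blast
  have "star a = star (x * a) * star a" using axa by (metis star_mult mult.assoc)
  then have xx: "x = star (x * a) * x" using w by (metis mult.assoc)
  then have "x * a = star (x * a) * (x * a)" by (metis mult.assoc)
  then show "star (x * a) = x * a" by (metis star_mult star_star)
  then show "x * a * x = x" using xx by metis
qed

lemma is_dual_core_inv_unique:
  assumes x: "is_dual_core_inv a x" and y: "is_dual_core_inv a y"
  shows "x = y"
proof -
  have axa: "a * x * a = a" "a * y * a = a"
    using x y unfolding is_dual_core_inv_def by auto
  have "x * a = x * a * (y * a)" "y * a = y * a * (x * a)"
    using axa by (metis mult.assoc)+
  then have e: "x * a = y * a"
    using is_dual_core_invD(1)[OF x] is_dual_core_invD(1)[OF y] by (metis star_mult)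
  obtain s where s: "x = s * y"
    using x y left_multsD unfolding is_dual_core_inv_def by metis
  have "x = x * (a * y)" using s is_dual_core_invD(2)[OF y] by (metis mult.assoc)
  also have "\<dots> = y" using e is_dual_core_invD(2)[OF y] by (metis mult.assoc)
  finally show ?thesis .
qed

lemma is_p_idem_unique:
  assumes x: "is_p_idem a x" and y: "is_p_idem a y"
  shows "x = y"
proof -
  obtain s t where "x = y * s" "y = x * t"
    using x y right_multsD unfolding is_p_idem_def by metis
  then have "y * x = x" "x * y = y"
    using x y unfolding is_p_idem_def by (metis mult.assoc)+
  then show ?thesis using x y unfolding is_p_idem_def by (metis star_mult)
qed

lemma is_r_idem_unique:
  assumes x: "is_r_idem a x" and y: "is_r_idem a y"
  shows "x = y"
proof -
  obtain s t where "x = s * y" "y = t * x"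
    using x y left_multsD unfolding is_r_idem_def by metis
  then have "x * y = x" "y * x = y"
    using x y unfolding is_r_idem_def by (metis mult.assoc)+
  then show ?thesis using x y unfolding is_r_idem_def by (metis star_mult)
qed

lemma is_q_idem_unique:
  assumes x: "is_q_idem a x" and y: "is_q_idem a y"
  shows "x = y"
proof -
  obtain s t where "x = y * s" "y = t * x"
    using x y right_multsD left_multsD unfolding is_q_idem_def by metis
  then have "y * x = x" "y * x = y"
    using x y unfolding is_q_idem_def by (metis mult.assoc)+
  then show ?thesis by simp
qed

end

theory Submission
  imports Defs
begin

text \<open>
  Everything can be read off from the group inverse \<open>g\<close> and the Moore-Penrose inverse \<open>m\<close> of
  an element \<open>x\<close>: \<open>p = x m\<close>, \<open>q = x g\<close>, \<open>r = m x\<close>, the core inverse is \<open>g x m\<close> and the dual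
  core inverse is \<open>m x g\<close>. Applying this to \<open>a\<close> and its four inverses reduces the theorem to
  exhibiting the pair \<open>(g, m)\<close> for each of these inverses, and to simplifying words in \<open>a\<close>,
  its group inverse and its Moore-Penrose inverse.
\<close>

lemma right_mults_eqI:
  fixes x y :: "'a::monoid_mult"
  assumes "x = y * s" "y = x * t"
  shows "right_mults x = right_mults y"
proof -
  have "\<exists>w. x * z = y * w" for z using assms(1) by (metis mult.assoc)
  moreover have "\<exists>w. y * z = x * w" for z using assms(2) by (metis mult.assoc)
  ultimately show ?thesis unfolding right_mults_def by blast
qed

lemma left_mults_eqI:
  fixes x y :: "'a::monoid_mult"
  assumes "x = s * y" "y = t * x"
  shows "left_mults x = left_mults y"
proof -
  have "\<exists>w. z * x = w * y" for z using assms(1) by (metis mult.assoc)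
  moreover have "\<exists>w. z * y = w * x" for z using assms(2) by (metis mult.assoc)
  ultimately show ?thesis unfolding left_mults_def by blast
qed

text \<open>A locale, so that every result can be interpreted again at each of the four inverses of
  \<open>a\<close>.\<close>

locale group_mp_inverses =
  fixes a g m :: "'a::involution_ring"
  assumes group_inv: "is_group_inv a g" and mp_inv: "is_mp_inv a m"
begin

lemma star_am: "star (a * m) = a * m" and star_ma: "star (m * a) = m * a"
  using mp_inv unfolding is_mp_inv_def by auto

text \<open>Oriented as rewrite rules for right-associated words. The mixed rules hold because
  \<open>g = a * g * g\<close> starts with \<open>a\<close>, which absorbs \<open>a * m\<close>, and
  \<open>g = g * g * a\<close> ends with \<open>a\<close>, which absorbs
  \<open>m * a\<close>.\<close>

lemma word_rules:
  "g * a = a * g" "a * (a * g) = a" "a * (g * g) = g"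
  "a * (m * a) = a" "m * (a * m) = m" "a * (m * g) = g" "g * (m * a) = g"
proof -
  have G: "a * g * a = a" "g * a * g = g" "a * g = g * a"
    using group_inv unfolding is_group_inv_def by auto
  have M: "a * m * a = a" "m * a * m = m"
    using mp_inv unfolding is_mp_inv_def by auto
  show "g * a = a * g" using G by simp
  show "a * (a * g) = a" using G by (metis mult.assoc)
  show "a * (g * g) = g" using G by (metis mult.assoc)
  show "a * (m * a) = a" "m * (a * m) = m" using M by (simp_all add: mult.assoc)
  show "a * (m * g) = g" using G M by (metis mult.assoc)
  show "g * (m * a) = g" using G M by (metis mult.assoc)
qed

text \<open>With the tail \<open>z\<close> the rules also apply in the middle of a right-associated
  word.\<close>

lemma word_rules_context:
  "g * (a * z) = a * (g * z)" "a * (a * (g * z)) = a * z" "a * (g * (g * z)) = g * z"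
  "a * (m * (a * z)) = a * z" "m * (a * (m * z)) = m * z"
  "a * (m * (g * z)) = g * z" "g * (m * (a * z)) = g * z"
  using word_rules by (metis mult.assoc)+

lemmas words = mult.assoc word_rules word_rules_context

lemma is_p: "is_p_idem a (a * m)"
proof -
  have "right_mults (a * m) = right_mults a"
    by (rule right_mults_eqI[where s = m and t = a]) (simp_all add: words)
  then show ?thesis unfolding is_p_idem_def by (simp add: star_am words)
qed

lemma is_r: "is_r_idem a (m * a)"
proof -
  have "left_mults (m * a) = left_mults a"
    by (rule left_mults_eqI[where s = m and t = a]) (simp_all add: words)
  then show ?thesis unfolding is_r_idem_def by (simp add: star_ma words)
qed

lemma is_q: "is_q_idem a (a * g)"
proof -
  have "right_mults (a * g) = right_mults a"
    by (rule right_mults_eqI[where s = g and t = a]) (simp_all add: words)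
  moreover have "left_mults (a * g) = left_mults a"
    by (rule left_mults_eqI[where s = g and t = a]) (simp_all add: words)
  ultimately show ?thesis unfolding is_q_idem_def by (simp add: words)
qed

lemma is_core: "is_core_inv a (g * a * m)"
proof -
  have right: "right_mults (g * a * m) = right_mults a"
    by (rule right_mults_eqI[where s = "g * m" and t = "a * a"]) (simp_all add: words)
  \<comment> \<open>Since \<open>a * m\<close> is self-adjoint, it equals
    \<open>star m * star a\<close>; this puts the element into the left ideal of
    \<open>star a\<close>.\<close>
  have "g * a * m = g * star m * star a"
    using star_am by (simp add: star_mult mult.assoc)
  moreover have "star a = star a * a * (g * a * m)"
  proof -
    have "star a = star (a * m * a)" by (simp add: words)
    also have "\<dots> = star a * (a * m)" by (metis star_mult star_am)
    also have "\<dots> = star a * a * (g * a * m)" by (simp add: words)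
    finally show ?thesis .
  qed
  ultimately have "left_mults (g * a * m) = left_mults (star a)" by (metis left_mults_eqI)
  with right show ?thesis unfolding is_core_inv_def by (simp add: words)
qed

lemma is_dual_core: "is_dual_core_inv a (m * a * g)"
proof -
  have left: "left_mults (m * a * g) = left_mults a"
    by (rule left_mults_eqI[where s = "m * g" and t = "a * a"]) (simp_all add: words)
  have "m * a * g = star a * (star m * g)"
    using star_ma by (simp add: star_mult mult.assoc[symmetric])
  moreover have "star a = m * a * g * (a * star a)"
  proof -
    have "star a = star (a * (m * a))" by (simp add: words)
    also have "\<dots> = m * a * star a" by (metis star_mult star_ma)
    also have "\<dots> = m * a * g * (a * star a)" by (simp add: words)
    finally show ?thesis .
  qed
  ultimately have "right_mults (m * a * g) = right_mults (star a)" by (metis right_mults_eqI)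
  with left show ?thesis unfolding is_dual_core_inv_def by (simp add: words)
qed

lemma invertible:
  "group_invertible a \<and> mp_invertible a \<and> core_invertible a \<and> dual_core_invertible a \<and>
    (\<exists>e. is_p_idem a e) \<and> (\<exists>e. is_q_idem a e) \<and> (\<exists>e. is_r_idem a e)"
  unfolding group_invertible_def mp_invertible_def core_invertible_def dual_core_invertible_def
  using group_inv mp_inv is_core is_dual_core is_p is_q is_r by blast

lemma descriptions:
  "group_inv a = g" "mp_inv a = m" "core_inv a = g * a * m" "dual_core_inv a = m * a * g"
  "p_idem a = a * m" "q_idem a = a * g" "r_idem a = m * a"
  unfolding group_inv_def mp_inv_def core_inv_def dual_core_inv_def
    p_idem_def q_idem_def r_idem_def
  by (blast intro: the_equality group_inv is_group_inv_unique mp_inv is_mp_inv_unique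
      is_core is_core_inv_unique is_dual_core is_dual_core_inv_unique
      is_p is_p_idem_unique is_q is_q_idem_unique is_r is_r_idem_unique)+

text \<open>These rules make \<open>s\<close> the idempotent \<open>q\<close> of \<open>m\<close>:
  it generates the same right and left ideals as \<open>m\<close>. Each comes from starring a word
  in \<open>a\<close>, \<open>g\<close>, \<open>m\<close>, where \<open>a * m\<close> and
  \<open>m * a\<close> are fixed by the involution.\<close>

lemma star_q_rules:
  defines "s \<equiv> star (a * g)"
  shows "s * m = m" "m * s = m" "s * (a * m) = s" "m * (a * s) = s" "s * s = s"
proof -
  have "s * (m * a) = star (m * a * (a * g))" unfolding s_def by (metis star_mult star_ma)
  then have "s * (m * a) = m * a" by (simp add: words star_ma)
  \<comment> \<open>Multiply by \<open>m\<close> on the right and use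
    \<open>m * a * m = m\<close>.\<close>
  then show "s * m = m" by (metis mult.assoc word_rules(5))
  have "a * m * s = star (a * g * (a * m))" unfolding s_def by (metis star_mult star_am)
  then have "a * m * s = a * m" by (simp add: words star_am)
  then show "m * s = m" by (metis mult.assoc word_rules(5))
  have "s * (a * m) = star (a * m * (a * g))" unfolding s_def by (metis star_mult star_am)
  then show "s * (a * m) = s" by (simp add: words s_def)
  have "m * a * s = star (a * g * (m * a))" unfolding s_def by (metis star_mult star_ma)
  then show "m * (a * s) = s" by (simp add: words s_def)
  have "s * s = star (a * g * (a * g))" unfolding s_def by (metis star_mult)
  then show "s * s = s" by (simp add: words s_def)
qed

lemma star_q_rules_context:
  defines "s \<equiv> star (a * g)"
  shows "s * (m * z) = m * z" "m * (s * z) = m * z" "s * (a * (m * z)) = s * z"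
    "m * (a * (s * z)) = s * z" "s * (s * z) = s * z"
  unfolding s_def using star_q_rules by (metis mult.assoc)+

lemmas star_q_words = star_q_rules star_q_rules_context

text \<open>The last element is \<open>r * a * p\<close>; its products with \<open>g\<close>
  collapse to the self-adjoint \<open>a * m\<close> and \<open>m * a\<close>.\<close>

lemma group_inv_inverses: "group_mp_inverses g a (m * a * a * a * m)"
  by unfold_locales (simp_all add: is_group_inv_def is_mp_inv_def words star_am star_ma)

text \<open>The Moore-Penrose conditions are symmetric in \<open>a\<close> and \<open>m\<close>. For
  the group inverse, both products with \<open>m\<close> reduce to
  \<open>star (a * g)\<close>.\<close>

lemma mp_inv_inverses: "group_mp_inverses m (star (a * g) * a * star (a * g)) a"
  by unfold_locales
    (simp_all add: is_group_inv_def is_mp_inv_def words star_q_words star_am star_ma)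

text \<open>One element serves as both inverses because its two products with
  \<open>g * a * m\<close> are the same self-adjoint \<open>a * m\<close>.\<close>

lemma core_inv_inverses: "group_mp_inverses (g * a * m) (a * a * m) (a * a * m)"
  by unfold_locales (simp_all add: is_group_inv_def is_mp_inv_def words star_am star_ma)

text \<open>Here both products are \<open>m * a\<close>.\<close>

lemma dual_core_inv_inverses: "group_mp_inverses (m * a * g) (m * a * a) (m * a * a)"
  by unfold_locales (simp_all add: is_group_inv_def is_mp_inv_def words star_am star_ma)

end

theorem theorem2p18:
  fixes a :: "'a::involution_ring"
  assumes "group_invertible a" and "mp_invertible a"
  shows
    "(\<forall>x \<in> {a, group_inv a, mp_inv a, core_inv a, dual_core_inv a}.
        group_invertible x \<and> mp_invertible x \<and> core_invertible x \<and> dual_core_invertible x \<and>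
        (\<exists>e. is_p_idem x e) \<and> (\<exists>e. is_q_idem x e) \<and> (\<exists>e. is_r_idem x e))
     \<and>
     (p_idem (group_inv a) = p_idem a \<and>
      q_idem (group_inv a) = q_idem a \<and>
      r_idem (group_inv a) = r_idem a \<and>
      group_inv (group_inv a) = a \<and>
      mp_inv (group_inv a) = r_idem a * a * p_idem a \<and>
      core_inv (group_inv a) = a * p_idem a \<and>
      dual_core_inv (group_inv a) = r_idem a * a)
     \<and>
     (p_idem (mp_inv a) = r_idem a \<and>
      q_idem (mp_inv a) = star (q_idem a) \<and>
      r_idem (mp_inv a) = p_idem a \<and>
      group_inv (mp_inv a) = star (q_idem a) * a * star (q_idem a) \<and>
      mp_inv (mp_inv a) = a \<and>
      core_inv (mp_inv a) = star (q_idem a) * a \<and>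
      dual_core_inv (mp_inv a) = a * star (q_idem a))
     \<and>
     (let b = core_inv a in
        p_idem b = p_idem a \<and> q_idem b = p_idem a \<and> r_idem b = p_idem a \<and>
        group_inv b = a * p_idem a \<and> mp_inv b = a * p_idem a \<and>
        core_inv b = a * p_idem a \<and> dual_core_inv b = a * p_idem a)
     \<and>
     (let c = dual_core_inv a in
        p_idem c = r_idem a \<and> q_idem c = r_idem a \<and> r_idem c = r_idem a \<and>
        group_inv c = r_idem a * a \<and> mp_inv c = r_idem a * a \<and>
        core_inv c = r_idem a * a \<and> dual_core_inv c = r_idem a * a)"
proof -
  obtain g m where "is_group_inv a g" "is_mp_inv a m"
    using assms unfolding group_invertible_def mp_invertible_def by blast
  then interpret A: group_mp_inverses a g m by unfold_locales
  interpret G: group_mp_inverses g a "m * a * a * a * m" by (rule A.group_inv_inverses)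
  interpret M: group_mp_inverses m "star (a * g) * a * star (a * g)" a
    by (rule A.mp_inv_inverses)
  interpret C: group_mp_inverses "g * a * m" "a * a * m" "a * a * m"
    by (rule A.core_inv_inverses)
  interpret D: group_mp_inverses "m * a * g" "m * a * a" "m * a * a"
    by (rule A.dual_core_inv_inverses)
  show ?thesis
    \<comment> \<open>Rewriting the inverses of \<open>a\<close> as words exposes the terms that the
      other four interpretations describe; only identities between words in \<open>a\<close>,
      \<open>g\<close>, \<open>m\<close> and \<open>star (a * g)\<close> remain.

      The comment at 357 above contains a stray symbol, so this corrected list replaces everything
      above.\<close>
    unfolding A.descriptions Let_def G.descriptions M.descriptions C.descriptions D.descriptions
    using A.invertible G.invertible M.invertible C.invertible D.invertible
    by (simp add: A.words A.star_q_words)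
qed

end
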